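(* Let $n\ge 3$. The maps $PC_n(\mathbb{R}_+^* )\to\mathbb{R}_+$ given by $$A=(a_{i,j})\mapsto \sup_{1\le i<j<k\le n} Kii_3(a_{i,j},a_{i,k},a_{j,k})\qquad\text{and}\qquad A\mapsto Kii_n(A)$$ are $Ad$-invariant inconsistency maps on $PC_n(\mathbb{R}_+^* )$.
   Context: $\mathbb{R}_+^*$ is the multiplicative group of positive reals. $PC_n(\mathbb{R}_+^* )$ is the set of $n\times n$ matrices $A=(a_{i,j})$ with coefficients in $\mathbb{R}_+^*$ such that $a_{j,i}=a_{i,j}^{-1}$ and $a_{i,i}=1$. $A$ is consistent if $a_{i,k}=a_{i,j}a_{j,k}$ for all $i,j,k$. Koczkodaj's maps are $$Kii_3(x,y,z)=1-\min\left\{\frac{y}{xz},\frac{xz}{y}\right\},$$ applied to a $3\times 3$ PC matrix through its upper triangle $(x,y,z)=(a_{1,2},a_{1,3},a_{2,3})$, and $$Kii_n(A)=1-\min_{1\le i<j\le n}\min\left(\frac{a_{i,j}}{a_{i,i+1}a_{i+1,i+2}\cdots a_{j-1,j}},\ \frac{a_{i,i+1}a_{i+1,i+2}\cdots a_{j-1,j}}{a_{i,j}}\right).$$ A map $ii_3$ on $3\times3$ PC matrices generates a map on $n\times n$ PC matrices by taking the supremum of $ii_3(B)$ over all $3\times3$ PC submatrices $B$ of $A$. An inconsistency map is a map $ii$ on the set of PC matrices, with values in a (semi-)normed vector space, such that $ii(A)=0$ whenever $A$ is consistent. It is $Ad$-invariant if $ii(Ad_g(A))=ii(A)$ for all $A$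 and all $g=(g_i)\in(\mathbb{R}_+^* )^n$, where $Ad_g(A)=(g_ia_{i,j}g_j^{-1})_{i,j}$. *)

theory Defs
  imports Complex_Main "HOL-Library.FuncSet" "Jordan_Normal_Form.Matrix"
begin

text \<open>
  Matrix indices run over 0, ..., n - 1 (the convention of the matrix library), so the
  index i of the usual 1-based notation is written i - 1 here.
\<close>

definition PC :: "nat \<Rightarrow> real mat set" where
  "PC n = {A \<in> carrier_mat n n.
     (\<forall>i<n. \<forall>j<n. A $$ (i, j) > 0) \<and>
     (\<forall>i<n. \<forall>j<n. A $$ (j, i) = inverse (A $$ (i, j))) \<and>
     (\<forall>i<n. A $$ (i, i) = 1)}"

definition consistent :: "nat \<Rightarrow> real mat \<Rightarrow> bool" where
  "consistent n A \<longleftrightarrow>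
     (\<forall>i<n. \<forall>j<n. \<forall>k<n. A $$ (i, k) = A $$ (i, j) * A $$ (j, k))"

definition Kii3 :: "real \<Rightarrow> real \<Rightarrow> real \<Rightarrow> real" where
  "Kii3 x y z = 1 - min (y / (x * z)) (x * z / y)"

text \<open>
  The index sets of the following minimum and supremum are finite, and nonempty for
  n at least 2 and n at least 3, respectively.
\<close>

definition Kii :: "nat \<Rightarrow> real mat \<Rightarrow> real" where
  "Kii n A = 1 - Min ((\<lambda>(i, j).
       min (A $$ (i, j) / (\<Prod>l = i..<j. A $$ (l, Suc l)))
           ((\<Prod>l = i..<j. A $$ (l, Suc l)) / A $$ (i, j))) ` {(i, j). i < j \<and> j < n})"

definition Kii3_sup :: "nat \<Rightarrow> real mat \<Rightarrow> real" where
  "Kii3_sup n A = (SUP (i, j, k) \<in> {(i, j, k). i < j \<and> j < k \<and> k < n}.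
       Kii3 (A $$ (i, j)) (A $$ (i, k)) (A $$ (j, k)))"

definition Ad :: "nat \<Rightarrow> real vec \<Rightarrow> real mat \<Rightarrow> real mat" where
  "Ad n g A = mat n n (\<lambda>(i, j). g $ i * A $$ (i, j) * inverse (g $ j))"

definition inconsistency_map :: "nat \<Rightarrow> (real mat \<Rightarrow> 'v::real_normed_vector) \<Rightarrow> bool" where
  "inconsistency_map n ii \<longleftrightarrow> (\<forall>A \<in> PC n. consistent n A \<longrightarrow> ii A = 0)"

definition Ad_invariant :: "nat \<Rightarrow> (real mat \<Rightarrow> 'v::real_normed_vector) \<Rightarrow> bool" where
  "Ad_invariant n ii \<longleftrightarrow>
     (\<forall>A \<in> PC n. \<forall>g \<in> carrier_vec n. (\<forall>i<n. g $ i > 0) \<longrightarrow> ii (Ad n g A) = ii A)"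

end

theory Submission
  imports Defs
begin

text \<open>
  Both maps are built from quotients of a coefficient by a product of coefficients along a path
  with the same end points. Under the adjoint action such a path product telescopes, so that it is
  multiplied by the same factor as the coefficient, and the quotient does not change; for a
  consistent matrix the path product equals the coefficient and the quotient is 1.
\<close>

text \<open>The two quotients are reciprocal, so they cannot both exceed 1. Nonnegativity of both
  maps rests on this bound.\<close>

lemma min_divide_swap_le_1:
  fixes x y :: real
  assumes "x > 0" "y > 0"
  shows "min (x / y) (y / x) \<le> 1"
  using assms by (cases "x \<le> y") (auto simp: min_le_iff_disj)

lemma Kii3_nonneg:
  assumes "x > 0" "y > 0" "z > 0"
  shows "Kii3 x y z \<ge> 0"
  unfolding Kii3_def using min_divide_swap_le_1[of y "x * z"] assms by simp

lemma Kii3_eq_0: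
  assumes "x > 0" "z > 0"
  shows "Kii3 x (x * z) z = 0"
  using assms by (simp add: Kii3_def)

text \<open>The middle weight \<open>b\<close> cancels in the product of the outer arguments, so
  that product and the middle argument both pick up the factor \<open>a * inverse c\<close>, which
  drops out of the two quotients.\<close>

lemma Kii3_scale:
  assumes "a > 0" "b > 0" "c > 0"
  shows "Kii3 (a * x * inverse b) (a * y * inverse c) (b * z * inverse c) = Kii3 x y z"
proof -
  have "a * x * inverse b * (b * z * inverse c) = (a * inverse c) * (x * z)"
    and "a * y * inverse c = (a * inverse c) * y"
    using assms by (simp_all add: field_simps)
  moreover have "a * inverse c \<noteq> 0"
    using assms by simp
  ultimately show ?thesis
    by (simp only: Kii3_def mult_divide_mult_cancel_left simp_thms)
qed

lemma PC_pos: "A \<in> PC n \<Longrightarrow> i < n \<Longrightarrow> j < n \<Longrightarrow> A $$ (i, j) > 0"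
  and PC_diag: "A \<in> PC n \<Longrightarrow> i < n \<Longrightarrow> A $$ (i, i) = 1"
  unfolding PC_def by blast+

lemma Ad_index:
  "i < n \<Longrightarrow> j < n \<Longrightarrow> Ad n g A $$ (i, j) = g $ i * A $$ (i, j) * inverse (g $ j)"
  by (simp add: Ad_def)

lemma finite_increasing_pairs: "finite {(i, j). i < j \<and> j < (n::nat)}"
  by (rule finite_subset[of _ "{..<n} \<times> {..<n}"]) auto

lemma finite_increasing_triples: "finite {(i, j, k). i < j \<and> j < k \<and> k < (n::nat)}"
  by (rule finite_subset[of _ "{..<n} \<times> {..<n} \<times> {..<n}"]) auto

text \<open>Induction on the end point: consistency at \<open>i\<close>, \<open>m\<close>,
  \<open>Suc m\<close> absorbs each new factor, and the empty product matches the diagonal entry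
  1.\<close>

lemma prod_superdiagonal_consistent:
  assumes "A \<in> PC n" "consistent n A" "i \<le> j" "j < n"
  shows "(\<Prod>l = i..<j. A $$ (l, Suc l)) = A $$ (i, j)"
  using \<open>i \<le> j\<close> \<open>j < n\<close>
proof (induction j rule: dec_induct)
  case base
  then show ?case using PC_diag[OF assms(1)] by simp
next
  case (step m)
  then have "i < n" "m < n" by auto
  then have "A $$ (i, Suc m) = A $$ (i, m) * A $$ (m, Suc m)"
    using assms(2) step.prems unfolding consistent_def by blast
  with step \<open>m < n\<close> show ?case by simp
qed

text \<open>Telescoping: the trailing \<open>inverse (g $ m)\<close> of the path up to
  \<open>m\<close> cancels against the leading \<open>g $ m\<close> of the next coefficient, so only
  the weights of the end points survive.\<close>

lemma prod_superdiagonal_Ad: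
  assumes "\<And>i. i < n \<Longrightarrow> g $ i > 0" "i \<le> j" "j < n"
  shows "(\<Prod>l = i..<j. Ad n g A $$ (l, Suc l))
       = g $ i * (\<Prod>l = i..<j. A $$ (l, Suc l)) * inverse (g $ j)"
  using \<open>i \<le> j\<close> \<open>j < n\<close>
proof (induction j rule: dec_induct)
  case base
  then show ?case using assms(1)[of i] by simp
next
  case (step m)
  then have "m < n" "g $ m \<noteq> 0" using assms(1)[of m] by auto
  with step show ?case by (simp add: Ad_index)
qed

lemma Kii3_sup_nonneg:
  assumes "n \<ge> 3" "A \<in> PC n"
  shows "Kii3_sup n A \<ge> 0"
proof -
  \<comment> \<open>A single nonnegative term bounds the supremum from below; this triple is
    available because \<open>n \<ge> 3\<close>.\<close>
  have "(0, 1, 2) \<in> {(i, j, k). i < j \<and> j < k \<and> k < n}"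
    using assms(1) by simp
  moreover have "Kii3 (A $$ (0, 1)) (A $$ (0, 2)) (A $$ (1, 2)) \<ge> 0"
    using assms by (intro Kii3_nonneg PC_pos[of A n]) auto
  ultimately show ?thesis
    unfolding Kii3_sup_def
    by (intro cSUP_upper2[where x = "(0, 1, 2)"])
      (auto intro!: bdd_above_finite finite_imageI finite_increasing_triples)
qed

lemma Kii3_sup_consistent:
  assumes "n \<ge> 3" "A \<in> PC n" "consistent n A"
  shows "Kii3_sup n A = 0"
proof -
  let ?T = "{(i, j, k). i < j \<and> j < k \<and> k < n}"
  \<comment> \<open>The supremum of a constant family is that constant only over a nonempty index
    set.\<close>
  have "(0, 1, 2) \<in> ?T"
    using assms(1) by simp
  then have nonempty: "?T \<noteq> {}"
    by blast
  have "Kii3 (A $$ (i, j)) (A $$ (i, k)) (A $$ (j, k)) = 0" if "i < j" "j < k" "k < n" for i j k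
  proof -
    have "A $$ (i, k) = A $$ (i, j) * A $$ (j, k)"
      using assms(3) that unfolding consistent_def by (meson less_trans)
    then show ?thesis
      using Kii3_eq_0 PC_pos[OF assms(2)] that by simp
  qed
  then have "Kii3_sup n A = (SUP t \<in> ?T. 0)"
    unfolding Kii3_sup_def by (intro SUP_cong) auto
  also have "\<dots> = 0"
    using nonempty by (rule cSUP_const)
  finally show ?thesis .
qed

lemma Kii3_sup_Ad:
  assumes "\<And>i. i < n \<Longrightarrow> g $ i > 0"
  shows "Kii3_sup n (Ad n g A) = Kii3_sup n A"
proof -
  have "Kii3 (Ad n g A $$ (i, j)) (Ad n g A $$ (i, k)) (Ad n g A $$ (j, k))
      = Kii3 (A $$ (i, j)) (A $$ (i, k)) (A $$ (j, k))" if "i < j" "j < k" "k < n" for i j k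
  proof -
    have "i < n" "j < n"
      using that by auto
    then show ?thesis
      using \<open>k < n\<close> by (simp only: Ad_index Kii3_scale assms)
  qed
  then show ?thesis
    unfolding Kii3_sup_def by (intro SUP_cong) auto
qed

lemma Kii_nonneg:
  assumes "n \<ge> 2" "A \<in> PC n"
  shows "Kii n A \<ge> 0"
proof -
  let ?P = "\<lambda>i j. \<Prod>l = i..<j. A $$ (l, Suc l)"
  let ?f = "\<lambda>(i, j). min (A $$ (i, j) / ?P i j) (?P i j / A $$ (i, j))"
  \<comment> \<open>One pair suffices to bound the minimum; for (0, 1) the path is the single
    coefficient itself.\<close>
  have "Min (?f ` {(i, j). i < j \<and> j < n}) \<le> ?f (0, 1)"
    using assms(1) finite_increasing_pairs by (intro Min_le finite_imageI imageI) auto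
  also have "\<dots> \<le> 1"
    using min_divide_swap_le_1[of "A $$ (0, 1)" "?P 0 1"] assms
      PC_pos[of A n 0 1] by simp
  finally show ?thesis
    by (simp add: Kii_def)
qed

lemma Kii_consistent:
  assumes "n \<ge> 2" "A \<in> PC n" "consistent n A"
  shows "Kii n A = 0"
proof -
  let ?S = "{(i, j). i < j \<and> j < n}"
  let ?P = "\<lambda>i j. \<Prod>l = i..<j. A $$ (l, Suc l)"
  have "(0, 1) \<in> ?S"
    using assms(1) by simp
  then have nonempty: "?S \<noteq> {}"
    by blast
  have "min (A $$ (i, j) / ?P i j) (?P i j / A $$ (i, j)) = 1" if "i < j" "j < n" for i j
    using prod_superdiagonal_consistent[OF assms(2,3), of i j] PC_pos[OF assms(2), of i j] that
    by simp
  then have "(\<lambda>(i, j). min (A $$ (i, j) / ?P i j) (?P i j / A $$ (i, j))) ` ?S = (\<lambda>_. 1) ` ?S"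
    by (intro image_cong) auto
  \<comment> \<open>Nonemptiness ensures that the image is this singleton, whose minimum is 1, and
    not the empty set.\<close>
  also have "\<dots> = {1}"
    using nonempty by (simp only: image_constant_conv if_False)
  finally show ?thesis
    by (simp add: Kii_def)
qed

lemma Kii_Ad:
  assumes "\<And>i. i < n \<Longrightarrow> g $ i > 0"
  shows "Kii n (Ad n g A) = Kii n A"
proof -
  let ?P = "\<lambda>A i j. \<Prod>l = i..<j. A $$ (l, Suc l)"
  let ?f = "\<lambda>A (i, j). min (A $$ (i, j) / ?P A i j) (?P A i j / A $$ (i, j))"
  have "?f (Ad n g A) (i, j) = ?f A (i, j)" if "i < j" "j < n" for i j
  proof -
    \<comment> \<open>Positivity makes the common factor \<open>g $ i * inverse (g $ j)\<close>
      nonzero, so it cancels in both quotients.\<close>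
    have "g $ i > 0" "g $ j > 0"
      using assms that by auto
    then show ?thesis
      using that prod_superdiagonal_Ad[OF assms, of n i j A] by (simp add: Ad_index)
  qed
  then have "?f (Ad n g A) ` {(i, j). i < j \<and> j < n} = ?f A ` {(i, j). i < j \<and> j < n}"
    by (intro image_cong) auto
  then show ?thesis
    by (simp only: Kii_def)
qed

theorem proposition3p10:
  fixes n :: nat
  assumes "n \<ge> 3"
  shows "Kii3_sup n \<in> PC n \<rightarrow> {0..} \<and> inconsistency_map n (Kii3_sup n) \<and> Ad_invariant n (Kii3_sup n) \<and>
         Kii n \<in> PC n \<rightarrow> {0..} \<and> inconsistency_map n (Kii n) \<and> Ad_invariant n (Kii n)"
proof -
  have "n \<ge> 2"
    using assms by simp
  then show ?thesis
    unfolding inconsistency_map_def Ad_invariant_def Pi_iff atLeast_iff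
    using assms
    by (intro conjI ballI impI Kii3_sup_nonneg Kii3_sup_consistent Kii3_sup_Ad
        Kii_nonneg Kii_consistent Kii_Ad) blast+
qed

end
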